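(* For all natural numbers $p \ge 4$ and $n \ge 1$, $$f(n,p,p-1) \le 2^{16p(\log n)^{1-1/(p-2)}\log\log n}.$$
   Context: Let $p,q$ be positive integers with $2 \le q \le \binom{p}{2}$. An edge-coloring of the complete graph $K_n$ is a $(p,q)$-coloring if every copy of $K_p$ in $K_n$ receives at least $q$ different colors on its edges. The function $f(n,p,q)$ is the minimum number of colors needed for $K_n$ to have a $(p,q)$-coloring. $\log$ denotes the base 2 logarithm. For $n=1$ (where $\log\log n$ is undefined) the exponent on the right-hand side is read as $0$. *)

theory Defs
  imports Complex_Main "HOL-Library.Ramsey"
begin

text \<open>The complete graph \<open>K_n\<close> has vertex set \<open>{..<n}\<close> and edge set \<open>nsets {..<n} 2\<close>; its copies of
  \<open>K_p\<close> are the sets in \<open>nsets {..<n} p\<close>. Only the values of \<open>c\<close> on edges matter.\<close>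

definition pq_coloring :: "nat \<Rightarrow> nat \<Rightarrow> nat \<Rightarrow> (nat set \<Rightarrow> 'c) \<Rightarrow> bool" where
  "pq_coloring n p q c \<longleftrightarrow> (\<forall>S \<in> nsets {..<n} p. q \<le> card (c ` nsets S 2))"

definition min_colors :: "nat \<Rightarrow> nat \<Rightarrow> nat \<Rightarrow> nat" where
  "min_colors n p q =
     (LEAST k. \<exists>c \<in> nsets {..<n} 2 \<rightarrow> {..<k}. pq_coloring n p q c)"

text \<open>The minimum is attained whenever \<open>q \<le> p choose 2\<close>, since a coloring with pairwise distinct
  colors on all edges is then a \<open>(p,q)\<close>-coloring.\<close>

lemma min_colors_attained:
  assumes "q \<le> p choose 2"
  shows "\<exists>c \<in> nsets {..<n} 2 \<rightarrow> {..<min_colors n p q}. pq_coloring n p q c"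
proof -
  have fin: "finite (nsets {..<n} 2)"
    by (simp add: finite_imp_finite_nsets)
  obtain c :: "nat set \<Rightarrow> nat"
    where c: "bij_betw c (nsets {..<n} 2) {..<card (nsets {..<n} 2)}"
    using ex_bij_betw_finite_nat[OF fin] by (auto simp: atLeast0LessThan)
  have "pq_coloring n p q c"
    unfolding pq_coloring_def
  proof
    fix S assume S: "S \<in> nsets {..<n} p"
    then have "nsets S 2 \<subseteq> nsets {..<n} 2"
      by (auto simp: nsets_def)
    then have "inj_on c (nsets S 2)"
      using c by (meson bij_betw_imp_inj_on inj_on_subset)
    then have "card (c ` nsets S 2) = card S choose 2"
      by (simp add: card_image card_nsets)
    then show "q \<le> card (c ` nsets S 2)"
      using S assms by (simp add: nsets_def)
  qed
  moreover have "c \<in> nsets {..<n} 2 \<rightarrow> {..<card (nsets {..<n} 2)}"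
    using c by (auto simp: bij_betw_def)
  ultimately show ?thesis
    unfolding min_colors_def
    by (intro LeastI[where P = "\<lambda>k. \<exists>c \<in> nsets {..<n} 2 \<rightarrow> {..<k}. pq_coloring n p q c"]) blast
qed

end

theory Submission
  imports Defs
begin

text \<open>
  Call a coloring rich up to size \<open>s\<close> if every set of at most \<open>s\<close> vertices sees, on its pairs, at
  least its size minus one colors. A coloring of \<open>K_n\<close> that is rich up to \<open>p\<close> is a
  \<open>(p,p-1)\<close>-coloring, so the task is to build rich colorings with few colors.

  They are built in levels. The vertices of one level are words whose letters are the vertices of the
  previous level, and two distinct words receive two pieces of information: the unordered pair of
  letters at the last position where they differ, and the list of the colors that the previous level
  gives to their letters, position by position. The complete information about a pair of letters
  costs few colors because it is kept for one position only, and the other positions are described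
  by the cheaper coloring of the previous level.

  The heart of the matter is that each level gains one unit of richness (\<open>refine_rich\<close>). Suppose
  that the letterwise coloring is rich up to \<open>s\<close> on words of every length, and let \<open>S\<close> be a set of
  \<open>s + 1\<close> words that sees at most \<open>s - 1\<close> refined colors. Removing any word leaves at least \<open>s - 1\<close> letterwise
  colors, so on \<open>S\<close> the letterwise color already determines the refined color. In particular, for
  pairs that differ in the first letter only, the color of the two letters determines the pair of
  letters. This rigidity makes a double count possible that splits the pairs of \<open>S\<close> by whether
  their tails agree, and it produces \<open>s\<close> colors after all.

  Level 0 consists of bit strings of length \<open>b\<close>, where the color of a pair is the first position at
  which they differ; letterwise it is rich up to 3 on words of every length. Level \<open>d\<close> has
  \<open>2 ^ (b ^ (d + 1))\<close> vertices, is rich up to \<open>d + 3\<close>, and uses at most \<open>(2 * b * 8 ^ d) ^ (b ^ d)\<close>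
  colors (\<open>exists_block_coloring\<close>). With \<open>d = p - 3\<close> and \<open>b\<close> the least integer with
  \<open>log n \<le> b ^ (p - 2)\<close> this gives the bound, except when \<open>log n\<close> is so small in terms of \<open>p\<close>
  that coloring all edges differently is good enough.
\<close>

section \<open>Rich colorings\<close>

definition pair_colors :: "('a \<Rightarrow> 'a \<Rightarrow> 'c) \<Rightarrow> 'a set \<Rightarrow> 'c set" where
  "pair_colors k S = (\<lambda>(v, w). k v w) ` {(v, w) \<in> S \<times> S. v \<noteq> w}"

text \<open>An infinite \<open>S\<close> has cardinality 0 here, so only finite sets are constrained.\<close>

definition rich :: "('a \<Rightarrow> 'a \<Rightarrow> 'c) \<Rightarrow> 'a set \<Rightarrow> nat \<Rightarrow> bool" where
  "rich k V s \<longleftrightarrow> (\<forall>S \<subseteq> V. card S \<le> s \<longrightarrow> card S \<le> Suc (card (pair_colors k S)))"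

abbreviation words :: "'b set \<Rightarrow> nat \<Rightarrow> 'b list set" where
  "words B r \<equiv> {xs. set xs \<subseteq> B \<and> length xs = r}"

text \<open>The pair at the last, rather than the first, difference is recorded so that removing the heads of
  both words leaves it unchanged as long as the tails differ.\<close>

fun last_diff :: "'b list \<Rightarrow> 'b list \<Rightarrow> 'b set" where
  "last_diff (x # xs) (y # ys) = (if xs = ys then if x = y then {} else {x, y} else last_diff xs ys)"
| "last_diff _ _ = {}"

definition refine :: "('b \<Rightarrow> 'b \<Rightarrow> 'c) \<Rightarrow> 'b list \<Rightarrow> 'b list \<Rightarrow> 'b set \<times> 'c list" where
  "refine g xs ys = (last_diff xs ys, map2 g xs ys)"

lemma pair_colorsI: "v \<in> S \<Longrightarrow> w \<in> S \<Longrightarrow> v \<noteq> w \<Longrightarrow> k v w \<in> pair_colors k S"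
  by (auto simp: pair_colors_def)

lemma pair_colorsE:
  assumes "c \<in> pair_colors k S"
  obtains v w where "v \<in> S" "w \<in> S" "v \<noteq> w" "c = k v w"
  using assms by (auto simp: pair_colors_def)

lemma pair_colors_mono: "S \<subseteq> T \<Longrightarrow> pair_colors k S \<subseteq> pair_colors k T"
  by (auto simp: pair_colors_def)

lemma finite_pair_colors: "finite S \<Longrightarrow> finite (pair_colors k S)"
  unfolding pair_colors_def
  by (rule finite_imageI, rule finite_subset[of _ "S \<times> S"]) auto

lemma richD: "rich k V s \<Longrightarrow> S \<subseteq> V \<Longrightarrow> card S \<le> s \<Longrightarrow> card S \<le> Suc (card (pair_colors k S))"
  by (simp add: rich_def)

text \<open>The color 0 is reserved for equal letters, so a letterwise color reveals at which positions the
  words agree.\<close>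

lemma map2_eq_zeros_iff:
  fixes g :: "'b \<Rightarrow> 'b \<Rightarrow> nat"
  assumes "\<And>x y. x \<in> B \<Longrightarrow> y \<in> B \<Longrightarrow> g x y = 0 \<longleftrightarrow> x = y"
    and "xs \<in> words B r" and "ys \<in> words B r"
  shows "map2 g xs ys = replicate r 0 \<longleftrightarrow> xs = ys"
proof -
  have "length xs = length ys \<Longrightarrow> set xs \<subseteq> B \<Longrightarrow> set ys \<subseteq> B \<Longrightarrow>
      map2 g xs ys = replicate (length xs) 0 \<longleftrightarrow> xs = ys"
    by (induction xs ys rule: list_induct2) (simp_all add: assms(1))
  then show ?thesis using assms(2,3) by simp
qed

section \<open>One level gains one unit of richness\<close>

text \<open>
  Let \<open>S\<close> be a counterexample of the shape explained above, let \<open>A\<close> be its set of tails, and call a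
  color emergent if it occurs on two words with the same tail. An emergent color \<open>k\<close> contains its
  two letters; \<open>R k\<close> is the set of tails over which \<open>k\<close> occurs. Every other color is the color \<open>\<phi>\<close>
  of two distinct tails with the color of two letters put in front of it.

  Fix \<open>\<phi>\<close>. If \<open>\<phi>\<close> occurs inside \<open>R k\<close>, then in \<open>S\<close> it is preceded both by 0 and by the letter color
  of \<open>k\<close>. The latter is different for different emergent \<open>k\<close> by rigidity, so \<open>\<phi>\<close> accounts for one
  color more than the number of emergent \<open>k\<close> with \<open>\<phi>\<close> occurring inside \<open>R k\<close>. Summing over all \<open>\<phi>\<close>
  and adding the emergent colors themselves gives at least
  \<open>c(A) + (\<Sum>k. 1 + c(R k)) \<ge> c(A) + (\<Sum>k. card (R k))\<close> colors, where \<open>c\<close> counts the refined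
  colors of a set of tails and the inequality is induction on the length. Finally
  \<open>c(A) \<ge> card A - 1\<close> by the same induction, and \<open>\<Sum>k. card (R k)\<close> is at least
  \<open>card S - card A\<close>, since every pair of words with a common tail contributes to it.
\<close>

lemma refine_rich:
  fixes g :: "'b \<Rightarrow> 'b \<Rightarrow> nat"
  assumes zero: "\<And>x y. x \<in> B \<Longrightarrow> y \<in> B \<Longrightarrow> g x y = 0 \<longleftrightarrow> x = y"
    and g_rich: "\<And>r. rich (map2 g) (words B r) s"
  shows "rich (refine g) (words B r) (Suc s)"
proof (induction r)
  case 0
  have "card S \<le> Suc 0" if "S \<subseteq> words B 0" for S
  proof -
    have "S \<subseteq> {[]}" using that by auto
    from card_mono[OF _ this] show ?thesis by simp
  qed
  then show ?case
    unfolding rich_def by (meson Suc_le_mono le0 le_trans)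
next
  case (Suc r)
  show ?case
    unfolding rich_def
  proof (intro allI impI, rule ccontr)
    fix S assume S: "S \<subseteq> words B (Suc r)" and card_S: "card S \<le> Suc s"
      and few: "\<not> card S \<le> Suc (card (pair_colors (refine g) S))"
    define PC where "PC = pair_colors (refine g)"
    have fin: "finite S" using few card.infinite by fastforce
    have fin_PC: "finite (PC S)" by (simp add: PC_def fin finite_pair_colors)
    have snd_PC: "snd ` PC S = pair_colors (map2 g) S"
      by (force simp: PC_def pair_colors_def refine_def)
    have PC_le: "card (snd ` PC S) \<le> card (PC S)"
      by (rule card_image_le[OF fin_PC])
    \<comment> \<open>The refined color determines the letterwise one, so smaller sets have enough colors.\<close>
    have "\<not> card S \<le> s"
    proof
      assume "card S \<le> s"
      from richD[OF g_rich S this] PC_le few show False by (simp add: PC_def flip: snd_PC)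
    qed
    then have "card S = Suc s" using card_S by simp
    then obtain v where v: "v \<in> S" by fastforce
    have "s \<le> Suc (card (pair_colors (map2 g) (S - {v})))"
      using richD[OF g_rich, of "S - {v}" "Suc r"] S v \<open>card S = Suc s\<close> fin by auto
    also have "card (pair_colors (map2 g) (S - {v})) \<le> card (snd ` PC S)"
      unfolding snd_PC by (intro card_mono finite_pair_colors fin pair_colors_mono) auto
    \<comment> \<open>Rigidity: refined and letterwise colors split the pairs of \<open>S\<close> in the same way.\<close>
    finally have "card (snd ` PC S) = card (PC S)"
      using PC_le few \<open>card S = Suc s\<close> by (simp add: PC_def)
    then have inj: "inj_on snd (PC S)"
      using fin_PC by (rule eq_card_imp_inj_on[rotated])
    define A where "A = tl ` S"
    have word: "b \<in> B \<and> a \<in> words B r \<and> a \<in> A" if "b # a \<in> S" for a b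
      using that S by (force simp: A_def)
    have A_ex: "\<exists>b. b # a \<in> S" if "a \<in> A" for a
    proof -
      from that obtain u where u: "u \<in> S" "a = tl u" by (auto simp: A_def)
      then have "u \<noteq> []" using S by auto
      then have "hd u # a = u" using u by simp
      then show ?thesis using u by metis
    qed
    then have A: "A \<subseteq> words B r" using word by blast
    have fin_A: "finite A" and card_A: "card A \<le> card S"
      by (auto simp: A_def fin card_image_le)
    have rich_A: "card U \<le> Suc (card (PC U))" if "U \<subseteq> A" for U
      using richD[OF Suc.IH, of U] that A card_mono[OF fin_A that] card_A card_S
      by (auto simp: PC_def)
    have PC_word: "snd \<phi> \<noteq> replicate r 0" if \<phi>: "\<phi> \<in> PC A" for \<phi>
    proof -
      from \<phi> obtain a a' where *: "a \<in> A" "a' \<in> A" "a \<noteq> a'" "\<phi> = refine g a a'"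
        unfolding PC_def by (rule pair_colorsE)
      then have "a \<in> words B r" "a' \<in> words B r" using A by blast+
      then show ?thesis
        using * map2_eq_zeros_iff[of B g a r a', OF zero] by (simp add: refine_def)
    qed
    \<comment> \<open>The color of \<open>b # a\<close> and \<open>b' # a'\<close>, given the color \<open>\<phi>\<close> of \<open>a\<close> and \<open>a'\<close> and the color \<open>\<gamma>\<close> of
      \<open>b\<close> and \<open>b'\<close>, for \<open>a \<noteq> a'\<close>.\<close>
    define ext where "ext = (\<lambda>(\<phi> :: 'b set \<times> nat list, \<gamma>). (fst \<phi>, \<gamma> # snd \<phi>))"
    have ext: "refine g (b # a) (b' # a') = ext (refine g a a', g b b')" if "a \<noteq> a'" for a a' b b'
      using that by (simp add: ext_def refine_def)
    have inj_ext: "inj ext"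
      by (auto simp: ext_def inj_def prod_eq_iff)
    \<comment> \<open>The emergent colors.\<close>
    define Em where "Em = {refine g (b # a) (b' # a) | a b b'. b # a \<in> S \<and> b' # a \<in> S \<and> b \<noteq> b'}"
    have Em_PC: "Em \<subseteq> PC S"
      by (auto simp: Em_def PC_def intro!: pair_colorsI)
    have fin_Em: "finite Em" using Em_PC fin_PC by (rule finite_subset)
    have Em_snd: "snd k = hd (snd k) # replicate r 0" if k: "k \<in> Em" for k
    proof -
      from k obtain a b b' where *: "b # a \<in> S" "k = refine g (b # a) (b' # a)"
        by (auto simp: Em_def)
      then show ?thesis
        using word[of b a] map2_eq_zeros_iff[of B g a r a, OF zero] by (auto simp: refine_def)
    qed
    have inj_hd: "inj_on (\<lambda>k. hd (snd k)) Em"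
    proof (rule inj_onI)
      fix k k' assume "k \<in> Em" "k' \<in> Em" "hd (snd k) = hd (snd k')"
      then have "snd k = snd k'" using Em_snd by metis
      then show "k = k'" using \<open>k \<in> Em\<close> \<open>k' \<in> Em\<close> Em_PC inj by (auto dest: inj_onD)
    qed
    define R where "R k = {a. \<exists>b b'. b # a \<in> S \<and> b' # a \<in> S \<and> b \<noteq> b' \<and> refine g (b # a) (b' # a) = k}"
      for k
    have R_A: "R k \<subseteq> A" for k using word by (auto simp: R_def)
    define \<Gamma> where "\<Gamma> \<phi> = {\<gamma>. ext (\<phi>, \<gamma>) \<in> PC S}" for \<phi>
    have fin_\<Gamma>: "finite (\<Gamma> \<phi>)" for \<phi>
    proof -
      have "\<Gamma> \<phi> \<subseteq> (\<lambda>c. hd (snd c)) ` PC S"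
        by (force simp: \<Gamma>_def ext_def)
      then show ?thesis using fin_PC finite_surj by blast
    qed
    define H where "H \<phi> = {k \<in> Em. \<phi> \<in> PC (R k)}" for \<phi>
    have \<Gamma>_ge: "Suc (card (H \<phi>)) \<le> card (\<Gamma> \<phi>)" if \<phi>: "\<phi> \<in> PC A" for \<phi>
    proof (cases "H \<phi> = {}")
      case True
      from \<phi> obtain a a' where *: "a \<in> A" "a' \<in> A" "a \<noteq> a'" "\<phi> = refine g a a'"
        unfolding PC_def by (rule pair_colorsE)
      then obtain b b' where "b # a \<in> S" "b' # a' \<in> S" using A_ex by metis
      then have "ext (\<phi>, g b b') \<in> PC S"
        using * ext[of a a' b b'] unfolding PC_def by (metis list.inject pair_colorsI)
      then have "\<Gamma> \<phi> \<noteq> {}" by (auto simp: \<Gamma>_def)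
      then show ?thesis using True fin_\<Gamma> by (simp add: Suc_le_eq card_gt_0_iff)
    next
      case False
      have both: "ext (\<phi>, 0) \<in> PC S \<and> ext (\<phi>, hd (snd k)) \<in> PC S \<and> hd (snd k) \<noteq> 0"
        if k: "k \<in> H \<phi>" for k
      proof -
        from k have "\<phi> \<in> pair_colors (refine g) (R k)" by (simp add: H_def PC_def)
        then obtain a a' where *: "a \<in> R k" "a' \<in> R k" "a \<noteq> a'" "\<phi> = refine g a a'"
          by (rule pair_colorsE)
        from \<open>a \<in> R k\<close> obtain b b' where b: "b # a \<in> S" "b' # a \<in> S" "b \<noteq> b'"
          "refine g (b # a) (b' # a) = k" by (auto simp: R_def)
        from \<open>a' \<in> R k\<close> obtain d d' where d: "d # a' \<in> S" "d' # a' \<in> S" "d \<noteq> d'"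
          "refine g (d # a') (d' # a') = k" by (auto simp: R_def)
        \<comment> \<open>Both tails carry the same two letters, so the letters can be combined freely in \<open>S\<close>.\<close>
        have "{b, b'} = {d, d'}"
          using b(3,4) d(3,4) by (auto simp: refine_def)
        then have ba': "b # a' \<in> S" "b' # a' \<in> S"
          using d by (auto simp: doubleton_eq_iff)
        have "g b b = 0" "g b b' \<noteq> 0" "hd (snd k) = g b b'"
          using zero word[OF b(1)] word[OF b(2)] b(3,4) by (auto simp: refine_def)
        moreover have "refine g (b # a) (b # a') \<in> PC S" "refine g (b # a) (b' # a') \<in> PC S"
          using b ba' \<open>a \<noteq> a'\<close> by (auto simp: PC_def intro!: pair_colorsI)
        ultimately show ?thesis
          using ext[OF \<open>a \<noteq> a'\<close>] * by metis
      qed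
      have H_Em: "H \<phi> \<subseteq> Em" by (auto simp: H_def)
      have "0 \<notin> (\<lambda>k. hd (snd k)) ` H \<phi>"
        using both by (metis imageE)
      then have "Suc (card (H \<phi>)) = card (insert 0 ((\<lambda>k. hd (snd k)) ` H \<phi>))"
        using finite_subset[OF H_Em fin_Em] inj_on_subset[OF inj_hd H_Em] by (simp add: card_image)
      also have "\<dots> \<le> card (\<Gamma> \<phi>)"
      proof (rule card_mono[OF fin_\<Gamma>])
        from False obtain k where "k \<in> H \<phi>" by blast
        then show "insert 0 ((\<lambda>k. hd (snd k)) ` H \<phi>) \<subseteq> \<Gamma> \<phi>"
          using both unfolding \<Gamma>_def by blast
      qed
      finally show ?thesis .
    qed
    have fin_PA: "finite (PC A)" by (simp add: PC_def fin_A finite_pair_colors)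
    \<comment> \<open>In an emergent color all entries but the first are 0.\<close>
    have disj: "Em \<inter> ext ` (SIGMA \<phi>:PC A. \<Gamma> \<phi>) = {}"
    proof (intro equalityI subsetI)
      fix c assume "c \<in> Em \<inter> ext ` (SIGMA \<phi>:PC A. \<Gamma> \<phi>)"
      then obtain \<phi> \<gamma> where "c \<in> Em" "\<phi> \<in> PC A" "c = ext (\<phi>, \<gamma>)" by auto
      then show "c \<in> {}" using Em_snd[of c] PC_word[of \<phi>] by (auto simp: ext_def)
    qed auto
    have "card Em + (\<Sum>\<phi>\<in>PC A. card (\<Gamma> \<phi>)) = card Em + card (ext ` (SIGMA \<phi>:PC A. \<Gamma> \<phi>))"
      using fin_PA fin_\<Gamma> by (simp add: card_image inj_on_subset[OF inj_ext])
    also have "\<dots> = card (Em \<union> ext ` (SIGMA \<phi>:PC A. \<Gamma> \<phi>))"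
      using fin_Em fin_PA fin_\<Gamma> disj by (subst card_Un_disjoint) auto
    also have "\<dots> \<le> card (PC S)"
      using Em_PC by (intro card_mono fin_PC) (auto simp: \<Gamma>_def)
    finally have count: "card Em + (\<Sum>\<phi>\<in>PC A. card (\<Gamma> \<phi>)) \<le> card (PC S)" .
    have "card Em + (card (PC A) + (\<Sum>k\<in>Em. card (PC (R k)))) =
          card Em + (\<Sum>\<phi>\<in>PC A. Suc (card (H \<phi>)))"
    proof -
      have "{\<phi> \<in> PC A. \<phi> \<in> PC (R k)} = PC (R k)" for k
        using pair_colors_mono[OF R_A, of "refine g" k] unfolding PC_def by blast
      then have "(\<Sum>k\<in>Em. card (PC (R k))) = (\<Sum>k\<in>Em. \<Sum>\<phi> | \<phi> \<in> PC A \<and> \<phi> \<in> PC (R k). 1)"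
        by simp
      also have "\<dots> = (\<Sum>\<phi>\<in>PC A. \<Sum>k | k \<in> Em \<and> \<phi> \<in> PC (R k). 1)"
        by (rule sum.swap_restrict[OF fin_Em fin_PA])
      also have "\<dots> = (\<Sum>\<phi>\<in>PC A. card (H \<phi>))" by (simp add: H_def)
      finally show ?thesis by (simp add: sum_Suc)
    qed
    also have "\<dots> \<le> card (PC S)"
      using count sum_mono[of "PC A" "\<lambda>\<phi>. Suc (card (H \<phi>))" "\<lambda>\<phi>. card (\<Gamma> \<phi>)", OF \<Gamma>_ge] by linarith
    finally have total: "card Em + (card (PC A) + (\<Sum>k\<in>Em. card (PC (R k)))) \<le> card (PC S)" .
    have "card S - card A \<le> (\<Sum>k\<in>Em. card (R k))"
    proof -
      \<comment> \<open>Choose a word over each tail; each of the other words is paired with the chosen one.\<close>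
      define b0 where "b0 a = (SOME b. b # a \<in> S)" for a
      have b0: "b0 a # a \<in> S" if "a \<in> A" for a
        unfolding b0_def using A_ex[OF that] by (rule someI_ex)
      define D where "D = S - (\<lambda>a. b0 a # a) ` A"
      have D: "\<exists>b a. u = b # a \<and> b # a \<in> S \<and> a \<in> A \<and> b \<noteq> b0 a" if "u \<in> D" for u
      proof -
        from that S have "u \<in> S" "u \<noteq> []" by (auto simp: D_def)
        then obtain b a where "u = b # a" "b # a \<in> S" by (cases u) auto
        then show ?thesis using that word by (auto simp: D_def)
      qed
      have "card S - card A \<le> card D"
        unfolding D_def
        by (meson card_image_le diff_card_le_card_Diff diff_le_mono2 fin_A finite_imageI le_trans)
      also have "card D \<le> card (SIGMA k:Em. R k)"
      proof (rule card_inj_on_le[where f = "\<lambda>u. (refine g (b0 (tl u) # tl u) u, tl u)"])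
        show "inj_on (\<lambda>u. (refine g (b0 (tl u) # tl u) u, tl u)) D"
        proof (rule inj_onI)
          fix u u' assume u: "u \<in> D" "u' \<in> D" and
            eq: "(refine g (b0 (tl u) # tl u) u, tl u) = (refine g (b0 (tl u') # tl u') u', tl u')"
          from D[OF u(1)] D[OF u(2)] eq show "u = u'"
            by (auto simp: refine_def doubleton_eq_iff)
        qed
        show "(\<lambda>u. (refine g (b0 (tl u) # tl u) u, tl u)) ` D \<subseteq> (SIGMA k:Em. R k)"
        proof
          fix z assume "z \<in> (\<lambda>u. (refine g (b0 (tl u) # tl u) u, tl u)) ` D"
          then obtain u where "u \<in> D" "z = (refine g (b0 (tl u) # tl u) u, tl u)" by auto
          moreover from D[OF \<open>u \<in> D\<close>] obtain b a where "u = b # a" "b # a \<in> S" "a \<in> A" "b \<noteq> b0 a"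
            by auto
          ultimately show "z \<in> (SIGMA k:Em. R k)"
            using b0[of a] by (fastforce simp: Em_def R_def)
        qed
        show "finite (SIGMA k:Em. R k)"
          using fin_Em finite_subset[OF R_A fin_A] by auto
      qed
      also have "\<dots> = (\<Sum>k\<in>Em. card (R k))"
        using fin_Em finite_subset[OF R_A fin_A] by simp
      finally show ?thesis .
    qed
    also have "\<dots> \<le> (\<Sum>k\<in>Em. Suc (card (PC (R k))))"
      by (intro sum_mono rich_A R_A)
    also have "\<dots> = card Em + (\<Sum>k\<in>Em. card (PC (R k)))"
      by (simp add: sum_Suc)
    finally have "card S \<le> Suc (card (PC S))"
      using total rich_A[of A] card_A by simp
    then show False using few by (simp add: PC_def)
  qed
qed


section \<open>Words as letters of the next level\<close>

lemma last_diff_same [simp]: "last_diff xs xs = {}"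
  by (cases xs) auto

lemma last_diff_commute: "last_diff xs ys = last_diff ys xs"
  by (induction xs ys rule: last_diff.induct) auto

lemma last_diff_append:
  assumes "length us = length ws" and "length xs = length ys"
  shows "last_diff (us @ xs) (ws @ ys) = (if xs = ys then last_diff us ws else last_diff xs ys)"
  using assms(1)
proof (induction us ws rule: list_induct2)
  case Nil
  then show ?case by simp
next
  case (Cons u us w ws)
  have "us @ xs = ws @ ys \<longleftrightarrow> us = ws \<and> xs = ys"
    using Cons.hyps by simp
  then show ?case using Cons.IH by (cases "xs = ys") auto
qed

lemma last_diff_in:
  "xs \<noteq> ys \<Longrightarrow> length xs = length ys \<Longrightarrow> set xs \<subseteq> B \<Longrightarrow> set ys \<subseteq> B \<Longrightarrow>
    last_diff xs ys \<in> (\<lambda>(x, y). {x, y}) ` (B \<times> B)"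
  by (induction xs ys rule: last_diff.induct) auto

text \<open>Richness passes from \<open>k'\<close> to any coloring \<open>k\<close> that is at least as fine along an injection.\<close>

lemma rich_transfer:
  assumes rich: "rich k' V' s" and inj: "inj_on \<phi> V" and into: "\<phi> ` V \<subseteq> V'"
    and det: "\<And>v w v' w'. v \<in> V \<Longrightarrow> w \<in> V \<Longrightarrow> v' \<in> V \<Longrightarrow> w' \<in> V \<Longrightarrow> k v w = k v' w' \<Longrightarrow>
      k' (\<phi> v) (\<phi> w) = k' (\<phi> v') (\<phi> w')"
  shows "rich k V s"
  unfolding rich_def
proof (intro allI impI)
  fix S assume S: "S \<subseteq> V" "card S \<le> s"
  show "card S \<le> Suc (card (pair_colors k S))"
  proof (cases "finite S")
    case True
    define F where "F c = (SOME d. \<exists>v\<in>S. \<exists>w\<in>S. k v w = c \<and> d = k' (\<phi> v) (\<phi> w))" for c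
    have F: "F (k v w) = k' (\<phi> v) (\<phi> w)" if "v \<in> S" "w \<in> S" for v w
    proof -
      have "\<exists>v'\<in>S. \<exists>w'\<in>S. k v' w' = k v w \<and> F (k v w) = k' (\<phi> v') (\<phi> w')"
        unfolding F_def by (rule someI_ex) (use that in blast)
      then show ?thesis using det S(1) that by (metis subsetD)
    qed
    have "card S = card (\<phi> ` S)"
      using inj_on_subset[OF inj S(1)] by (simp add: card_image)
    also have "\<dots> \<le> Suc (card (pair_colors k' (\<phi> ` S)))"
      using richD[OF rich, of "\<phi> ` S"] S into \<open>card S = card (\<phi> ` S)\<close> by auto
    also have "pair_colors k' (\<phi> ` S) \<subseteq> F ` pair_colors k S"
    proof
      fix c assume "c \<in> pair_colors k' (\<phi> ` S)"
      then obtain v w where "v \<in> S" "w \<in> S" "\<phi> v \<noteq> \<phi> w" "c = k' (\<phi> v) (\<phi> w)"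
        by (auto elim!: pair_colorsE)
      then show "c \<in> F ` pair_colors k S"
        using F[of v w] pair_colorsI[of v S w k] by (metis imageI)
    qed
    then have "card (pair_colors k' (\<phi> ` S)) \<le> card (pair_colors k S)"
      by (rule surj_card_le[OF finite_pair_colors[OF True]])
    finally show ?thesis by simp
  qed simp
qed

text \<open>Letters and colors are encoded as natural numbers so that all levels share one type. Richness is
  required letterwise on words of every length, since this is what the next level consumes.\<close>

definition block_coloring :: "nat \<Rightarrow> nat \<Rightarrow> nat \<Rightarrow> (nat \<Rightarrow> nat \<Rightarrow> nat) \<Rightarrow> bool" where
  "block_coloring m K s g \<longleftrightarrow>
    (\<forall>x<m. \<forall>y<m. g x y = g y x \<and> g x y < K \<and> (g x y = 0 \<longleftrightarrow> x = y)) \<and>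
    (\<forall>r. rich (map2 g) (words {..<m} r) s)"

text \<open>
  The new letters are the words of length \<open>b\<close>. A word of new letters flattens to a longer word of old
  letters, and the list of its new letter colors determines the refined color of the flattened
  words: the last difference lies in the last block that differs, and every new letter color
  contains the old letter colors of its block. So \<open>refine_rich\<close>, for flattened words, supplies
  the richness.
\<close>

lemma block_coloring_step:
  assumes g: "block_coloring m K s g"
  obtains g' where "block_coloring (m ^ b) (Suc (m\<^sup>2 * K ^ b)) (Suc s) g'"
proof -
  have sym: "g x y = g y x" and less: "g x y < K" and zero: "g x y = 0 \<longleftrightarrow> x = y"
    if "x \<in> {..<m}" "y \<in> {..<m}" for x y
    using g that by (auto simp: block_coloring_def)
  have g_rich: "rich (map2 g) (words {..<m} r) s" for r
    using g by (simp add: block_coloring_def)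
  define W where "W = words {..<m} b"
  have fin_W: "finite W" and card_W: "card W = m ^ b"
    by (simp_all add: W_def finite_lists_length_eq card_lists_length_eq)
  obtain dec where dec: "bij_betw dec {..<m ^ b} W"
    using ex_bij_betw_nat_finite[OF fin_W] by (auto simp: card_W atLeast0LessThan)
  have dec_W: "dec x \<in> W" if "x < m ^ b" for x
    using dec that by (auto simp: bij_betw_def)
  have dec_eq: "dec x = dec y \<longleftrightarrow> x = y" if "x < m ^ b" "y < m ^ b" for x y
    using dec that by (auto simp: bij_betw_def inj_on_def)
  define C where "C = pair_colors (refine g) W"
  have fin_C: "finite C" by (simp add: C_def fin_W finite_pair_colors)
  obtain code where code: "bij_betw code C {..<card C}"
    using ex_bij_betw_finite_nat[OF fin_C] by (auto simp: atLeast0LessThan)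
  have card_C: "card C \<le> m\<^sup>2 * K ^ b"
  proof -
    define P where "P = (\<lambda>(x, y). {x, y}) ` ({..<m} \<times> {..<m})"
    have "card P \<le> card ({..<m} \<times> {..<m})"
      unfolding P_def by (intro card_image_le) auto
    then have card_P: "finite P" "card P \<le> m\<^sup>2"
      by (auto simp: P_def power2_eq_square)
    have "C \<subseteq> P \<times> words {..<K} b"
    proof
      fix c assume "c \<in> C"
      then obtain v w where vw: "v \<in> W" "w \<in> W" "v \<noteq> w" and c: "c = refine g v w"
        unfolding C_def by (rule pair_colorsE)
      then have len: "length v = b" "length w = b" and sub: "set v \<subseteq> {..<m}" "set w \<subseteq> {..<m}"
        by (auto simp: W_def)
      have "set (map2 g v w) \<subseteq> {..<K}"
      proof
        fix z assume "z \<in> set (map2 g v w)"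
        then obtain x y where xy: "(x, y) \<in> set (zip v w)" "z = g x y" by auto
        have "x \<in> {..<m}" "y \<in> {..<m}"
          using set_zip_leftD[OF xy(1)] set_zip_rightD[OF xy(1)] sub by blast+
        then show "z \<in> {..<K}" using less xy(2) by simp
      qed
      moreover have "last_diff v w \<in> P"
        unfolding P_def using last_diff_in vw(3) len sub by metis
      ultimately show "c \<in> P \<times> words {..<K} b"
        using len by (simp add: c refine_def)
    qed
    then have "card C \<le> card (P \<times> words {..<K} b)"
      using card_P by (intro card_mono finite_cartesian_product) (auto simp: finite_lists_length_eq)
    also have "\<dots> \<le> m\<^sup>2 * K ^ b"
      using card_P by (simp add: card_cartesian_product card_lists_length_eq)
    finally show ?thesis .
  qed
  define g' where "g' x y = (if x = y then 0 else Suc (code (refine g (dec x) (dec y))))" for x y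
  have zero': "g' x y = 0 \<longleftrightarrow> x = y" for x y by (simp add: g'_def)
  have in_C: "refine g (dec x) (dec y) \<in> C" if "x < m ^ b" "y < m ^ b" "x \<noteq> y" for x y
    using that dec_W dec_eq by (auto simp: C_def intro!: pair_colorsI)
  have refine_commute: "refine g v w = refine g w v" if "v \<in> W" "w \<in> W" for v w
  proof -
    have "length v = length w \<Longrightarrow> set v \<subseteq> {..<m} \<Longrightarrow> set w \<subseteq> {..<m} \<Longrightarrow> map2 g v w = map2 g w v"
      by (induction v w rule: list_induct2) (use sym in auto)
    then show ?thesis using that by (simp add: refine_def last_diff_commute W_def)
  qed
  have g'_det: "refine g (dec x) (dec y) = refine g (dec x') (dec y')"
    if "x < m ^ b" "y < m ^ b" "x' < m ^ b" "y' < m ^ b" "g' x y = g' x' y'" for x y x' y'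
  proof (cases "x = y")
    case True
    then have "x' = y'" using that zero' by metis
    moreover have "map2 g v v = replicate b 0" if "v \<in> W" for v
      using map2_eq_zeros_iff[of "{..<m}" g v b v, OF zero] that by (auto simp: W_def)
    ultimately show ?thesis using True dec_W that by (simp add: refine_def)
  next
    case False
    then have "x' \<noteq> y'" using that zero' by metis
    with False that have "code (refine g (dec x) (dec y)) = code (refine g (dec x') (dec y'))"
      by (simp add: g'_def)
    then show ?thesis
      using code in_C False \<open>x' \<noteq> y'\<close> that by (auto simp: bij_betw_def dest: inj_onD)
  qed
  \<comment> \<open>A word of new letters, spelled out in old letters.\<close>
  define flat where "flat v = concat (map dec v)" for v
  have flat: "flat v \<in> words {..<m} (r * b)" if "v \<in> words {..<m ^ b} r" for v r
  proof -
    have "set v \<subseteq> {..<m ^ b} \<Longrightarrow> set (flat v) \<subseteq> {..<m} \<and> length (flat v) = length v * b"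
      by (induction v) (use dec_W in \<open>auto simp: flat_def W_def\<close>)
    then show ?thesis using that by simp
  qed
  have flat_eq: "flat v = flat w \<longleftrightarrow> v = w" if "v \<in> words {..<m ^ b} r" "w \<in> words {..<m ^ b} r" for v w r
  proof -
    have "length v = length w \<Longrightarrow> set v \<subseteq> {..<m ^ b} \<Longrightarrow> set w \<subseteq> {..<m ^ b} \<Longrightarrow>
        flat v = flat w \<longleftrightarrow> v = w"
    proof (induction v w rule: list_induct2)
      case (Cons x v y w)
      then have "length (dec x) = length (dec y)" using dec_W by (auto simp: W_def)
      then show ?case using Cons dec_eq by (simp add: flat_def)
    qed simp
    then show ?thesis using that by simp
  qed
  have flat_det: "refine g (flat v) (flat w) = refine g (flat v') (flat w')"
    if "v \<in> words {..<m ^ b} r" "w \<in> words {..<m ^ b} r" "v' \<in> words {..<m ^ b} r"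
      "w' \<in> words {..<m ^ b} r" "map2 g' v w = map2 g' v' w'" for v w v' w' r
  proof -
    have "length v = length w \<Longrightarrow> length w = length v' \<Longrightarrow> length v' = length w' \<Longrightarrow>
        set v \<subseteq> {..<m ^ b} \<Longrightarrow> set w \<subseteq> {..<m ^ b} \<Longrightarrow> set v' \<subseteq> {..<m ^ b} \<Longrightarrow>
        set w' \<subseteq> {..<m ^ b} \<Longrightarrow> map2 g' v w = map2 g' v' w' \<Longrightarrow>
        refine g (flat v) (flat w) = refine g (flat v') (flat w')"
    proof (induction v w v' w' rule: list_induct4)
      case (Cons x v y w x' v' y' w')
      note len = Cons.hyps
      have IH: "refine g (flat v) (flat w) = refine g (flat v') (flat w')"
        using Cons by simp
      have head: "refine g (dec x) (dec y) = refine g (dec x') (dec y')"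
        using Cons.prems by (intro g'_det) auto
      have "v = w \<longleftrightarrow> v' = w'"
        using map2_eq_zeros_iff[of "{..<m ^ b}" g' v "length v" w, OF zero']
          map2_eq_zeros_iff[of "{..<m ^ b}" g' v' "length v" w', OF zero'] Cons by simp
      moreover have words: "v \<in> words {..<m ^ b} (length v)" "w \<in> words {..<m ^ b} (length v)"
          "v' \<in> words {..<m ^ b} (length v)" "w' \<in> words {..<m ^ b} (length v)"
        using Cons.prems len by auto
      ultimately have eq: "flat v = flat w \<longleftrightarrow> flat v' = flat w'"
        using flat_eq[OF words(1,2)] flat_eq[OF words(3,4)] by (simp only:)
      have lens: "length (dec x) = b" "length (dec y) = b" "length (dec x') = b" "length (dec y') = b"
        using dec_W Cons.prems by (auto simp: W_def)
      have split: "flat (z # u) = dec z @ flat u" for z u by (simp add: flat_def)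
      show ?case
        using IH head eq flat[OF words(1)] flat[OF words(2)] flat[OF words(3)] flat[OF words(4)] lens
        by (simp add: refine_def split last_diff_append)
    qed simp
    then show ?thesis using that by simp
  qed
  have "block_coloring (m ^ b) (Suc (m\<^sup>2 * K ^ b)) (Suc s) g'"
    unfolding block_coloring_def
  proof (intro conjI allI impI)
    fix x y assume xy: "x < m ^ b" "y < m ^ b"
    show "g' x y = g' y x" using xy dec_W refine_commute by (simp add: g'_def)
    show "g' x y = 0 \<longleftrightarrow> x = y" by (rule zero')
    show "g' x y < Suc (m\<^sup>2 * K ^ b)"
    proof (cases "x = y")
      case False
      then have "code (refine g (dec x) (dec y)) < card C"
        using code in_C xy by (auto simp: bij_betw_def)
      then show ?thesis using card_C by (simp add: g'_def)
    qed (simp add: g'_def)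
  next
    fix r
    show "rich (map2 g') (words {..<m ^ b} r) (Suc s)"
    proof (rule rich_transfer)
      show "rich (refine g) (words {..<m} (r * b)) (Suc s)"
        by (rule refine_rich[OF zero g_rich])
      show "inj_on flat (words {..<m ^ b} r)" using flat_eq by (auto intro!: inj_onI)
      show "flat ` words {..<m ^ b} r \<subseteq> words {..<m} (r * b)" using flat by blast
    qed (rule flat_det)
  qed
  then show ?thesis by (rule that)
qed


section \<open>Iterating the construction\<close>

text \<open>Three distinct words always see two colors: at a position where the letters are not all equal,
  a common color of all three pairs would be a bit position at which three letters differ pairwise.\<close>

lemma first_bit_coloring:
  "block_coloring (2 ^ b) (Suc b) 3 (\<lambda>x y. if x = y then 0 else Suc (LEAST i. bit x i \<noteq> bit y i))"
proof -
  define fb :: "nat \<Rightarrow> nat \<Rightarrow> nat" where "fb x y = (LEAST i. bit x i \<noteq> bit y i)" for x y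
  define g where "g x y = (if x = y then 0 else Suc (fb x y))" for x y
  have fb: "bit x (fb x y) \<noteq> bit y (fb x y)" if "x \<noteq> y" for x y
  proof -
    from that obtain i where "bit x i \<noteq> bit y i" by (auto simp: bit_eq_iff)
    then show ?thesis unfolding fb_def by (rule LeastI)
  qed
  have bound: "i < b" if "x < 2 ^ b" "bit x i" for x i :: nat
    using that by (metis bit_take_bit_iff take_bit_nat_eq_self)
  have fb_less: "fb x y < b" if "x < 2 ^ b" "y < 2 ^ b" "x \<noteq> y" for x y
    using fb[OF that(3)] bound that by blast
  have comm: "fb x y = fb y x" for x y
    unfolding fb_def by (intro arg_cong[where f = Least] ext) blast
  have no_mono: False if "length u = length v" "length v = length w" "u \<noteq> v"
    "map2 g u v = map2 g u w" "map2 g u v = map2 g v w" for u v w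
    using that
  proof (induction u v w rule: list_induct3)
    case (Cons x u y v z w)
    show ?case
    proof (cases "x = y")
      case True
      then show ?thesis using Cons by simp
    next
      case False
      moreover from this have "x \<noteq> z" "y \<noteq> z" "fb x y = fb x z" "fb x y = fb y z"
        using Cons.prems by (auto simp: g_def split: if_splits)
      ultimately show ?thesis using fb[of x y] fb[of x z] fb[of y z] by metis
    qed
  qed simp
  have "rich (map2 g) (words {..<2 ^ b} r) 3" for r
    unfolding rich_def
  proof (intro allI impI)
    fix S :: "nat list set" assume S: "S \<subseteq> words {..<2 ^ b} r" "card S \<le> 3"
    define P where "P = pair_colors (map2 g) S"
    have "card S \<le> Suc (card P)"
    proof (cases "card S \<le> 1")
      case False
      then have fin: "finite S" using card.infinite by fastforce
      obtain u v where uv: "u \<in> S" "v \<in> S" "u \<noteq> v"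
        using False card_le_Suc0_iff_eq[OF fin] by auto
      have fin_P: "finite P" unfolding P_def by (rule finite_pair_colors[OF fin])
      have in_P: "map2 g u v \<in> P" unfolding P_def by (rule pair_colorsI[OF uv])
      show ?thesis
      proof (cases "card S \<le> 2")
        case True
        have "0 < card P" using in_P fin_P by (auto simp: card_gt_0_iff)
        then show ?thesis using True by simp
      next
        case False
        then have "\<not> S \<subseteq> {u, v}" using card_mono[of "{u, v}" S] uv by auto
        then obtain w where w: "w \<in> S" "u \<noteq> w" "v \<noteq> w" by blast
        have uw: "map2 g u w \<in> P" "map2 g v w \<in> P"
          unfolding P_def by (rule pair_colorsI; fact)+
        have "length u = length v" "length v = length w"
          using S(1) uv w by auto
        then have "map2 g u v \<noteq> map2 g u w \<or> map2 g u v \<noteq> map2 g v w"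
          using no_mono[of u v w] uv(3) by blast
        then have "\<not> card P \<le> Suc 0"
          using in_P uw card_le_Suc0_iff_eq[OF fin_P] by blast
        then show ?thesis using S(2) by simp
      qed
    qed simp
    then show "card S \<le> Suc (card (pair_colors (map2 g) S))" by (simp only: P_def)
  qed
  moreover have "g x y = g y x \<and> g x y < Suc b \<and> (g x y = 0 \<longleftrightarrow> x = y)"
    if "x < 2 ^ b" "y < 2 ^ b" for x y
    using fb_less[OF that] comm[of x y] by (simp add: g_def)
  ultimately have "block_coloring (2 ^ b) (Suc b) 3 g"
    unfolding block_coloring_def by (intro conjI allI impI) simp_all
  moreover have "g = (\<lambda>x y. if x = y then 0 else Suc (LEAST i. bit x i \<noteq> bit y i))"
    by (simp add: g_def fb_def fun_eq_iff)
  ultimately show ?thesis by simp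
qed

text \<open>A step turns \<open>K\<close> colors into \<open>m\<^sup>2 * K ^ b + 1\<close>, where \<open>m = 2 ^ (b ^ (d + 1))\<close>. The
  summand 1 is absorbed by a third factor \<open>m\<close>, and \<open>m ^ 3 = 8 ^ (b ^ (d + 1))\<close>, so every step
  contributes one factor 8 to the base of the bound.\<close>

lemma exists_block_coloring:
  assumes "b \<ge> 1"
  shows "\<exists>K g. block_coloring (2 ^ (b ^ Suc d)) K (d + 3) g \<and> K \<le> (2 * b * 8 ^ d) ^ (b ^ d)"
proof (induction d)
  case 0
  have "Suc b \<le> (2 * b * 8 ^ 0) ^ (b ^ 0)" using assms by simp
  then show ?case using first_bit_coloring[of b] by auto
next
  case (Suc d)
  then obtain K g where g: "block_coloring (2 ^ (b ^ Suc d)) K (d + 3) g"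
    and K: "K \<le> (2 * b * 8 ^ d) ^ (b ^ d)" by blast
  define m where "m = (2 :: nat) ^ (b ^ Suc d)"
  define X where "X = (2 * b * 8 ^ d) ^ (b ^ Suc d)"
  obtain g' where g': "block_coloring (m ^ b) (Suc (m\<^sup>2 * K ^ b)) (Suc (d + 3)) g'"
    using block_coloring_step g unfolding m_def by blast
  have "K ^ b \<le> X"
    using power_mono[OF K, of b] by (simp add: X_def power_mult[symmetric] mult.commute)
  moreover have "X \<ge> 1" using assms by (simp add: X_def)
  moreover have "m \<ge> 2" using self_le_power[of 2 "b ^ Suc d"] assms by (simp add: m_def)
  ultimately have "Suc (m\<^sup>2 * K ^ b) \<le> m * (m\<^sup>2 * X)"
  proof -
    assume *: "K ^ b \<le> X" "X \<ge> 1" "m \<ge> 2"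
    have "m\<^sup>2 * K ^ b \<le> m\<^sup>2 * X" using *(1) by simp
    moreover have "1 \<le> m\<^sup>2 * X" using *(2,3) by simp
    moreover have "2 * (m\<^sup>2 * X) \<le> m * (m\<^sup>2 * X)" by (rule mult_le_mono1[OF *(3)])
    ultimately show ?thesis by linarith
  qed
  also have "m * (m\<^sup>2 * X) = (2 * b * 8 ^ Suc d) ^ (b ^ Suc d)"
  proof -
    have "m * m\<^sup>2 = 8 ^ (b ^ Suc d)"
      by (simp add: m_def power2_eq_square flip: power_mult_distrib)
    then have "m * (m\<^sup>2 * X) = 8 ^ (b ^ Suc d) * X" by (metis mult.assoc)
    also have "\<dots> = (8 * (2 * b * 8 ^ d)) ^ (b ^ Suc d)"
      by (simp only: X_def power_mult_distrib[of 8 "2 * b * 8 ^ d"])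
    also have "8 * (2 * b * 8 ^ d) = 2 * b * 8 ^ Suc d" by simp
    finally show ?thesis .
  qed
  finally have "Suc (m\<^sup>2 * K ^ b) \<le> (2 * b * 8 ^ Suc d) ^ (b ^ Suc d)" .
  moreover have "m ^ b = 2 ^ (b ^ Suc (Suc d))"
    by (simp add: m_def mult.commute flip: power_mult)
  ultimately show ?case using g' by auto
qed

section \<open>Bounds on the number of colors\<close>

lemma min_colors_le:
  assumes "c ` nsets {..<n} 2 \<subseteq> {..<k}" and "pq_coloring n p q c"
  shows "min_colors n p q \<le> k"
  unfolding min_colors_def using assms by (intro Least_le) blast

lemma min_colors_le_choose:
  assumes "q \<le> p choose 2"
  shows "min_colors n p q \<le> n choose 2"
proof -
  have "finite (nsets {..<n} 2)" and card: "card (nsets {..<n} 2) = n choose 2"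
    by (simp_all add: finite_imp_finite_nsets card_nsets)
  then obtain c :: "nat set \<Rightarrow> nat" where c: "bij_betw c (nsets {..<n} 2) {..<n choose 2}"
    using ex_bij_betw_finite_nat by (metis atLeast0LessThan)
  have "q \<le> card (c ` nsets S 2)" if S: "S \<in> nsets {..<n} p" for S
  proof -
    have "nsets S 2 \<subseteq> nsets {..<n} 2" using S by (auto simp: nsets_def)
    then have "inj_on c (nsets S 2)" using c by (meson bij_betw_imp_inj_on inj_on_subset)
    then have "card (c ` nsets S 2) = card S choose 2" by (simp add: card_image card_nsets)
    then show ?thesis using S assms by (simp add: nsets_def)
  qed
  then show ?thesis
    using c by (intro min_colors_le[of c]) (auto simp: pq_coloring_def bij_betw_def)
qed

text \<open>Letters are words of length 1, so a block coloring is itself rich.\<close>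

lemma min_colors_le_block_coloring:
  assumes g: "block_coloring m K p g" and "n \<le> m"
  shows "min_colors n p (p - 1) \<le> K"
proof (rule min_colors_le)
  define c where "c e = g (Min e) (Max e)" for e
  have sym: "g x y = g y x" and less: "g x y < K" if "x < m" "y < m" for x y
    using g that by (auto simp: block_coloring_def)
  have c_pair: "c {x, y} = g x y" if "x < m" "y < m" for x y
    using sym[OF that] by (cases "x \<le> y") (auto simp: c_def max_def min_def)
  show "c ` nsets {..<n} 2 \<subseteq> {..<K}"
  proof
    fix z assume "z \<in> c ` nsets {..<n} 2"
    then obtain x y where "x < n" "y < n" "z = c {x, y}"
      by (auto simp: nsets_2_eq)
    then show "z \<in> {..<K}" using c_pair less \<open>n \<le> m\<close> by simp
  qed
  have g_rich: "rich g {..<m} p"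
  proof (rule rich_transfer)
    show "rich (map2 g) (words {..<m} 1) p" using g by (simp add: block_coloring_def)
    show "inj_on (\<lambda>x. [x]) {..<m}" by (simp add: inj_on_def)
    show "(\<lambda>x. [x]) ` {..<m} \<subseteq> words {..<m} 1" by auto
  qed simp
  show "pq_coloring n p (p - 1) c"
    unfolding pq_coloring_def
  proof
    fix S assume "S \<in> nsets {..<n} p"
    then have S: "finite S" "card S = p" "S \<subseteq> {..<m}" using \<open>n \<le> m\<close> by (auto simp: nsets_def)
    have "pair_colors g S \<subseteq> c ` nsets S 2"
    proof
      fix z assume "z \<in> pair_colors g S"
      then obtain x y where "x \<in> S" "y \<in> S" "x \<noteq> y" "z = g x y" by (rule pair_colorsE)
      moreover from this have "x < m" "y < m" using S(3) by auto
      then have "c {x, y} = g x y" by (rule c_pair)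
      moreover have "{x, y} \<in> nsets S 2"
        using \<open>x \<in> S\<close> \<open>y \<in> S\<close> \<open>x \<noteq> y\<close> by (simp add: nsets_def)
      ultimately show "z \<in> c ` nsets S 2" by (metis imageI)
    qed
    then have "card (pair_colors g S) \<le> card (c ` nsets S 2)"
      using S by (intro card_mono finite_imageI finite_imp_finite_nsets) auto
    then show "p - 1 \<le> card (c ` nsets S 2)"
      using richD[OF g_rich S(3)] S(2) by simp
  qed
qed


section \<open>The choice of parameters\<close>

lemma loglog_ge:
  assumes "n \<ge> (3 :: nat)"
  shows "log 2 (log 2 n) \<ge> 1 / 2" and "log 2 n \<ge> 3 / 2"
proof -
  have "3 = log 2 (2 ^ 3 :: real)" by (simp only: log_pow_cancel)
  also have "\<dots> \<le> log 2 (3 ^ 2)" by (intro log_mono) auto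
  also have "\<dots> = 2 * log 2 3" by (subst log_nat_power) auto
  also have "log 2 3 \<le> log 2 n" using assms by (intro log_mono) auto
  finally show L: "log 2 n \<ge> 3 / 2" by simp
  have "1 = log 2 (2 :: real)" by simp
  also have "\<dots> \<le> log 2 ((3 / 2) ^ 2)" by (intro log_mono) (auto simp: power2_eq_square)
  also have "\<dots> = 2 * log 2 (3 / 2)" by (subst log_nat_power) auto
  also have "log 2 (3 / 2) \<le> log 2 (log 2 n)" using L by (intro log_mono) auto
  finally show "log 2 (log 2 n) \<ge> 1 / 2" by simp
qed

theorem theorem1p1:
  fixes p n :: nat
  assumes "p \<ge> 4" and "n \<ge> 1"
  shows "real (min_colors n p (p - 1)) \<le>
    2 powr (if n = 1 then 0
            else 16 * real p * (log 2 (real n)) powr (1 - 1 / (real p - 2))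
                   * log 2 (log 2 (real n)))"
proof -
  have "p - 1 \<le> p choose 2"
  proof -
    have "(p - 1) * 2 \<le> (p - 1) * p" using assms(1) by (intro mult_le_mono2) simp
    then show ?thesis unfolding choose_two mult.commute[of p] by linarith
  qed
  then have trivial: "min_colors n p (p - 1) \<le> n choose 2" by (rule min_colors_le_choose)
  consider "n = 1" | "n = 2" | "n \<ge> 3" using assms(2) by linarith
  then show ?thesis
  proof cases
    case 1
    then show ?thesis using trivial by (simp add: choose_two)
  next
    case 2
    then show ?thesis using trivial by (simp add: choose_two)
  next
    case 3
    define L where "L = log 2 (real n)"
    define l where "l = log 2 L"
    define d where "d = p - 3"
    define B where "B = L powr (1 / (real p - 2))"
    have L: "L \<ge> 3 / 2" and l: "l \<ge> 1 / 2"
      using loglog_ge[OF 3] by (simp_all add: L_def l_def)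
    have p: "p = d + 3" "d \<ge> 1" using assms(1) by (auto simp: d_def)
    have B: "B > 0" using L by (simp add: B_def)
    have B_pow: "B ^ k = L powr (real k / (real p - 2))" for k
      using B L by (simp add: B_def powr_powr flip: powr_realpow)
    have L_eq: "L = B * B ^ d"
    proof -
      have "B * B ^ d = B ^ Suc d" by simp
      also have "\<dots> = L" unfolding B_pow using p L by simp
      finally show ?thesis by simp
    qed
    have exponent: "L powr (1 - 1 / (real p - 2)) = B ^ d"
      unfolding B_pow using p by (simp add: field_simps)
    \<comment> \<open>The exponent in the theorem, expressed by the real number \<open>B\<close> with \<open>B ^ (p - 2) = log n\<close>.\<close>
    define R where "R = 16 * real p * B ^ d * l"
    have "real (min_colors n p (p - 1)) \<le> 2 powr R"
    proof (cases "B \<le> 8 * real p * l")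
      case True
      \<comment> \<open>Pairwise distinct colors suffice, because \<open>n\<^sup>2 = 2 powr (2 * B * B ^ d)\<close>.\<close>
      have "real (min_colors n p (p - 1)) \<le> real (n choose 2)" using trivial by simp
      also have "\<dots> \<le> real (n ^ 2)"
        using 3 by (intro of_nat_mono binomial_le_pow) simp
      also have "\<dots> = (2 powr L) powr 2" using 3 by (simp add: L_def)
      also have "\<dots> = 2 powr (2 * B * B ^ d)" by (simp add: powr_powr L_eq mult_ac)
      also have "2 * B * B ^ d \<le> R"
        using mult_right_mono[OF True, of "2 * B ^ d"] B by (simp add: R_def mult_ac)
      finally show ?thesis by simp
    next
      case False
      \<comment> \<open>Here \<open>B\<close> is large compared to \<open>p\<close>, so rounding it up to \<open>b\<close> costs at most a factor 2 in
        \<open>B ^ d\<close>.\<close>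
      define b where "b = nat \<lceil>B\<rceil>"
      have "4 * real p \<le> 8 * real p * l"
        using mult_left_mono[OF l, of "8 * real p"] by simp
      then have B_large: "B \<ge> 4 * real p" using False by linarith
      have "B \<ge> 4" using B_large p by simp
      have b: "B \<le> real b" "real b \<le> B + 1" "b \<ge> 1"
        using B unfolding b_def by linarith+
      obtain K g where g: "block_coloring (2 ^ (b ^ Suc d)) K p g"
        and K: "K \<le> (2 * b * 8 ^ d) ^ (b ^ d)"
        using exists_block_coloring[OF b(3), of d] p by auto
      have "L \<le> real b ^ Suc d"
        using power_mono[OF b(1), of "Suc d"] B L_eq by simp
      then have "real n \<le> 2 powr real (b ^ Suc d)"
        using 3 unfolding L_def by (subst (asm) log_le_iff) auto
      then have "real n \<le> 2 ^ (b ^ Suc d)" by (simp only: powr_realpow zero_less_numeral)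
      then have "n \<le> 2 ^ (b ^ Suc d)" by (simp only: of_nat_le_numeral_power_cancel_iff)
      from min_colors_le_block_coloring[OF g this] K
      have "min_colors n p (p - 1) \<le> (2 * b * 8 ^ d) ^ (b ^ d)" by linarith
      then have "real (min_colors n p (p - 1)) \<le> real ((2 * b * 8 ^ d) ^ (b ^ d))"
        by (simp only: of_nat_le_iff)
      also have "\<dots> = (2 * real b * 8 ^ d) ^ (b ^ d)" by simp
      also have "\<dots> = (2 powr log 2 (2 * real b * 8 ^ d)) powr real (b ^ d)"
        using b(3) by (subst powr_log_cancel) (auto simp: powr_realpow simp del: of_nat_power)
      also have "\<dots> = 2 powr (real b ^ d * log 2 (2 * real b * 8 ^ d))"
        unfolding powr_powr by (simp add: mult.commute)
      also have "real b ^ d * log 2 (2 * real b * 8 ^ d) \<le> R"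
      proof -
        have "l = (real d + 1) * log 2 B"
          unfolding l_def L_eq using B by (simp add: log_mult log_nat_power algebra_simps)
        moreover have "log 2 B \<ge> 0" using \<open>B \<ge> 4\<close> by simp
        ultimately have logB: "log 2 B \<le> l" by (simp add: algebra_simps)
        have "log 2 (real b) \<le> log 2 (2 * B)"
          using b \<open>B \<ge> 4\<close> by (intro log_mono) auto
        also have "\<dots> = 1 + log 2 B" using B by (simp add: log_mult)
        finally have log_b: "log 2 (real b) \<le> 1 + l" using logB by simp
        have "log 2 (8 ^ d :: real) = 3 * real d"
        proof -
          have "log 2 (8 :: real) = 3" using log_pow_cancel[of 2 3] by simp
          then show ?thesis by (simp add: log_nat_power)
        qed
        then have "log 2 (2 * real b * 8 ^ d) = 1 + log 2 (real b) + 3 * real d"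
          using b(3) by (simp add: log_mult)
        also have "\<dots> \<le> 8 * real p * l"
        proof -
          have "2 + l + 3 * real d \<le> 3 * real p * (2 * l)"
          proof -
            have "1 * real d \<le> 2 * l * real d" using l by (intro mult_right_mono) auto
            moreover have "3 * real p * (2 * l) = 3 * (2 * l * real d) + 18 * l"
              by (simp add: p algebra_simps)
            ultimately show ?thesis using l by linarith
          qed
          also have "\<dots> \<le> 8 * real p * l" using l by simp
          finally show ?thesis using log_b by linarith
        qed
        finally have factor: "log 2 (2 * real b * 8 ^ d) \<le> 8 * real p * l" .
        have "B * (1 + 1 / B) = B + 1" using B by (simp add: distrib_left)
        then have "real b ^ d \<le> (B * (1 + 1 / B)) ^ d"
          using b(2) by (intro power_mono) simp_all
        also have "\<dots> = B ^ d * (1 + 1 / B) ^ d" by (rule power_mult_distrib)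
        also have "(1 + 1 / B) ^ d \<le> exp (1 / B) ^ d"
          using B by (intro power_mono exp_ge_add_one_self) auto
        also have "exp (1 / B) ^ d = exp (real d / B)" by (simp flip: exp_of_nat_mult)
        also have "\<dots> \<le> 2"
        proof -
          have "real d / B \<le> 1 / 2" using B_large p B by (simp add: divide_le_eq)
          then show ?thesis using exp_bound_half[of "real d / B"] B by simp
        qed
        finally have "real b ^ d \<le> B ^ d * 2" using B by simp
        then have "real b ^ d * (8 * real p * l) \<le> (B ^ d * 2) * (8 * real p * l)"
          using l by (intro mult_right_mono) auto
        moreover have "real b ^ d * log 2 (2 * real b * 8 ^ d) \<le> real b ^ d * (8 * real p * l)"
          using factor by (intro mult_left_mono) auto
        ultimately have "real b ^ d * log 2 (2 * real b * 8 ^ d) \<le> (B ^ d * 2) * (8 * real p * l)"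
          by linarith
        then show ?thesis by (simp add: R_def mult_ac)
      qed
      finally show ?thesis by simp
    qed
    moreover have "R = 16 * real p * log 2 (real n) powr (1 - 1 / (real p - 2)) *
        log 2 (log 2 (real n))"
      unfolding R_def l_def exponent[symmetric] L_def ..
    ultimately show ?thesis using 3 by simp
  qed
qed

end
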